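(* For every real number $\tau$, the polynomial $$f(z,\tau)=\frac{2\sqrt2\,\mathrm{i}\cos \tau-1-3\sin \tau}{15} + \frac{3+\sin\tau}{10}\,z + \frac{3-\sin \tau}{10}\, z^2 +\frac{2\sqrt2\,\mathrm{i}\cos \tau-1+3\sin \tau}{15}\, z^3$$ satisfies $|f(z,\tau)|\le 3/5$ for all $z\in\mathbb{T}$. Moreover, the Sidon constant of $\{0,1,2,3\}$ satisfies $$\frac53\le S(\{0,1,2,3\})<\sqrt{3}.$$
   Context: $\mathbb{T}=\{z\in\mathbb{C}:|z|=1\}$ and $\mathrm{i}$ is the imaginary unit. For a finite nonempty set $\Lambda=\{\lambda_0,\dots,\lambda_{n-1}\}$ of $n$ distinct integers, the Sidon constant $S(\Lambda)$ is the inverse of the minimum of $\max_{z\in\mathbb{T}}\bigl|\sum_{j=0}^{n-1}c_jz^{\lambda_j}\bigr|$ over all complex coefficients $c_0,\dots,c_{n-1}$ with $|c_0|+\dots+|c_{n-1}|=1$. Equivalently, $S(\Lambda)$ is the smallest constant $C$ such that $\sum_{j}|c_j|\le C\max_{z\in\mathbb{T}}\bigl|\sum_{j}c_jz^{\lambda_j}\bigr|$ for all complex $c_0,\dots,c_{n-1}$. *)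

theory Defs
  imports "HOL-Analysis.Analysis"
begin

definition trig_poly :: "int set \<Rightarrow> (int \<Rightarrow> complex) \<Rightarrow> complex \<Rightarrow> complex" where
  "trig_poly \<Lambda> c z = (\<Sum>k\<in>\<Lambda>. c k * z powi k)"

definition circle_max :: "(complex \<Rightarrow> complex) \<Rightarrow> real" where
  "circle_max p = (SUP z\<in>sphere 0 1. cmod (p z))"

(* Meant for finite nonempty frequency sets. The infimum is then a minimum and the
   supremum in circle_max a maximum; see Sidon_constant_min and circle_max_trig_poly
   below. *)
definition Sidon_constant :: "int set \<Rightarrow> real" where
  "Sidon_constant \<Lambda> =
     inverse (INF c\<in>{c. (\<Sum>k\<in>\<Lambda>. cmod (c k)) = 1}. circle_max (trig_poly \<Lambda> c))"

definition sidon_f :: "complex \<Rightarrow> real \<Rightarrow> complex" where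
  "sidon_f z \<tau> =
     (2 * sqrt 2 * \<i> * cos \<tau> - 1 - 3 * sin \<tau>) / 15
     + (3 + sin \<tau>) / 10 * z
     + (3 - sin \<tau>) / 10 * z ^ 2
     + (2 * sqrt 2 * \<i> * cos \<tau> - 1 + 3 * sin \<tau>) / 15 * z ^ 3"

lemma continuous_on_trig_poly: "continuous_on (sphere 0 1) (trig_poly \<Lambda> c)"
  unfolding trig_poly_def by (intro continuous_intros) auto

lemma bdd_above_trig_poly: "bdd_above ((\<lambda>z. cmod (trig_poly \<Lambda> c z)) ` sphere 0 1)"
  by (intro bounded_imp_bdd_above compact_imp_bounded compact_continuous_image
      continuous_intros continuous_on_trig_poly compact_sphere)

lemma circle_max_trig_poly:
  "\<exists>z\<in>sphere 0 1. circle_max (trig_poly \<Lambda> c) = cmod (trig_poly \<Lambda> c z) \<and>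
     (\<forall>w\<in>sphere 0 1. cmod (trig_poly \<Lambda> c w) \<le> cmod (trig_poly \<Lambda> c z))"
proof -
  have "\<exists>z\<in>sphere 0 1. \<forall>w\<in>sphere 0 1. cmod (trig_poly \<Lambda> c w) \<le> cmod (trig_poly \<Lambda> c z)"
    by (intro continuous_attains_sup continuous_intros continuous_on_trig_poly) auto
  then obtain z where z: "z \<in> sphere 0 1"
    "\<forall>w\<in>sphere 0 1. cmod (trig_poly \<Lambda> c w) \<le> cmod (trig_poly \<Lambda> c z)"
    by blast
  moreover have "circle_max (trig_poly \<Lambda> c) = cmod (trig_poly \<Lambda> c z)"
    unfolding circle_max_def using z by (intro cSup_eq_maximum) auto
  ultimately show ?thesis
    by blast
qed

lemma circle_max_diff_le:
  "circle_max (trig_poly \<Lambda> c) - circle_max (trig_poly \<Lambda> d) \<le> (\<Sum>k\<in>\<Lambda>. cmod (c k - d k))"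
proof -
  obtain z where z: "z \<in> sphere 0 1" "circle_max (trig_poly \<Lambda> c) = cmod (trig_poly \<Lambda> c z)"
    using circle_max_trig_poly by blast
  have "cmod (trig_poly \<Lambda> d z) \<le> circle_max (trig_poly \<Lambda> d)"
    unfolding circle_max_def using z by (intro cSUP_upper bdd_above_trig_poly)
  moreover have "cmod (trig_poly \<Lambda> c z) - cmod (trig_poly \<Lambda> d z)
      \<le> cmod (trig_poly \<Lambda> c z - trig_poly \<Lambda> d z)"
    by (rule norm_triangle_ineq2)
  moreover have "trig_poly \<Lambda> c z - trig_poly \<Lambda> d z = (\<Sum>k\<in>\<Lambda>. (c k - d k) * z powi k)"
    by (simp add: trig_poly_def sum_subtractf algebra_simps)
  moreover have "cmod (\<Sum>k\<in>\<Lambda>. (c k - d k) * z powi k) \<le> (\<Sum>k\<in>\<Lambda>. cmod (c k - d k))"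
    using z by (intro sum_norm_le) (simp add: norm_mult norm_power_int)
  ultimately show ?thesis
    using z by simp
qed

lemma Sidon_constant_min:
  assumes "finite \<Lambda>" "\<Lambda> \<noteq> {}"
  shows "\<exists>c. (\<Sum>k\<in>\<Lambda>. cmod (c k)) = 1 \<and>
           Sidon_constant \<Lambda> = inverse (circle_max (trig_poly \<Lambda> c)) \<and>
           (\<forall>d. (\<Sum>k\<in>\<Lambda>. cmod (d k)) = 1 \<longrightarrow>
              circle_max (trig_poly \<Lambda> c) \<le> circle_max (trig_poly \<Lambda> d))"
proof -
  define N where "N c = circle_max (trig_poly \<Lambda> c)" for c
  define B where "B = (PiE UNIV (\<lambda>k. if k \<in> \<Lambda> then cball 0 1 else {0}) :: (int \<Rightarrow> complex) set)"
  define K where "K = B \<inter> {c. (\<Sum>k\<in>\<Lambda>. cmod (c k)) = 1}"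
  have coord: "continuous_on S (\<lambda>c. c k)" for S :: "(int \<Rightarrow> complex) set" and k
    by (rule continuous_on_subset[OF continuous_on_product_coordinates]) simp
  have "compactin (product_topology (\<lambda>_. euclidean) UNIV) B"
    unfolding B_def by (subst compactin_PiE) auto
  then have "compact B"
    by (simp add: euclidean_product_topology)
  moreover have "closed {c::int \<Rightarrow> complex. (\<Sum>k\<in>\<Lambda>. cmod (c k)) = 1}"
    by (intro closed_Collect_eq continuous_intros coord)
  ultimately have K: "compact K"
    unfolding K_def by blast
  obtain k0 where k0: "k0 \<in> \<Lambda>"
    using assms by blast
  have "(\<lambda>k. if k = k0 then 1 else 0) \<in> K"
    using k0 assms by (auto simp: K_def B_def if_distrib[of cmod] sum.delta cong: if_cong split: if_splits)
  then have "K \<noteq> {}"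
    by blast
  moreover have "continuous_on K N"
    unfolding continuous_on_def
  proof
    fix c assume c: "c \<in> K"
    have "continuous_on K (\<lambda>d. \<Sum>k\<in>\<Lambda>. cmod (d k - c k))"
      by (intro continuous_intros coord)
    then have *: "((\<lambda>d. \<Sum>k\<in>\<Lambda>. cmod (d k - c k)) \<longlongrightarrow> 0) (at c within K)"
      using c by (fastforce simp: continuous_on_def)
    have "\<bar>N d - N c\<bar> \<le> (\<Sum>k\<in>\<Lambda>. cmod (d k - c k))" for d
      using circle_max_diff_le[of \<Lambda> c d] circle_max_diff_le[of \<Lambda> d c]
      by (auto simp: N_def norm_minus_commute abs_le_iff)
    then have "((\<lambda>d. N d - N c) \<longlongrightarrow> 0) (at c within K)"
      by (intro Lim_null_comparison[OF _ *]) auto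
    then show "(N \<longlongrightarrow> N c) (at c within K)"
      using Lim_null by blast
  qed
  ultimately obtain c where c: "c \<in> K" "\<forall>d\<in>K. N c \<le> N d"
    using continuous_attains_inf[OF K] by blast
  have min: "N c \<le> N d" if d: "(\<Sum>k\<in>\<Lambda>. cmod (d k)) = 1" for d
  proof -
    define d' where "d' = (\<lambda>k. if k \<in> \<Lambda> then d k else 0)"
    have "cmod (d k) \<le> 1" if "k \<in> \<Lambda>" for k
      using member_le_sum[OF that, of "\<lambda>k. cmod (d k)"] assms d by simp
    then have "d' \<in> K"
      using d by (auto simp: d'_def K_def B_def)
    moreover have "trig_poly \<Lambda> d' = trig_poly \<Lambda> d"
      by (auto simp: trig_poly_def d'_def fun_eq_iff)
    ultimately show ?thesis
      using c by (metis N_def)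
  qed
  have "(INF c\<in>{c. (\<Sum>k\<in>\<Lambda>. cmod (c k)) = 1}. N c) = N c"
    using c min by (intro cInf_eq_minimum) (auto simp: K_def)
  then show ?thesis
    using c min by (intro exI[of _ c]) (auto simp: Sidon_constant_def N_def K_def)
qed

end

theory Submission
  imports Defs
begin

text \<open>
  The polynomial \<open>f(\<cdot>, \<tau>)\<close> is extremal: \<open>9/25 - |f(w\<^sup>2, \<tau>)|\<^sup>2\<close> is the square of a real polynomial
  in the real and imaginary parts of \<open>w\<close>. As its coefficients have absolute sum \<open>1\<close>, this gives
  the lower bound for the Sidon constant.

  For the upper bound, averaging \<open>|p|\<^sup>2\<close> over the three cube roots of a suitable unimodular number
  gives \<open>(|c\<^sub>0| + |c\<^sub>3|)\<^sup>2 + |c\<^sub>1|\<^sup>2 + |c\<^sub>2|\<^sup>2 \<le> max |p|\<^sup>2\<close>, and Cauchy-Schwarz yields the constant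
  \<open>\<surd>3\<close>. If it were attained, the nonnegative trigonometric polynomial \<open>max |p|\<^sup>2 - |p|\<^sup>2\<close> would have
  double zeros at these three points, so its middle coefficients, which are the autocorrelations of
  the sequence \<open>c\<close> at lags \<open>1\<close> and \<open>2\<close>, would vanish; this forces \<open>c\<^sub>1 c\<^sub>2 = 0\<close>.
\<close>

section \<open>The extremal polynomials\<close>

text \<open>Scaling by 30 clears denominators and turns the bound 3/5 into 18, whose square is 324.
  The square root of \<open>z\<close> enters because the half-angle relations
  \<open>1 - x = 2 * v^2\<close>, \<open>1 + x = 2 * u^2\<close>, \<open>y = 2 * u * v\<close> are
  what make the difference a perfect square.\<close>

lemma sidon_f_identity:
  fixes u v \<tau> :: real
  assumes "u\<^sup>2 + v\<^sup>2 = 1"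
  shows "324 - (30 * cmod (sidon_f ((Complex u v)\<^sup>2) \<tau>))\<^sup>2 =
    (6 * cos \<tau> * (1 + 4 * (u\<^sup>2 - v\<^sup>2)) * v
      - 8 * sqrt 2 * sin \<tau> * (2 * (u\<^sup>2 - v\<^sup>2) - 1) * u)\<^sup>2"
proof -
  define k s r x y where defs: "k = cos \<tau>" "s = sin \<tau>" "r = sqrt 2" "x = u\<^sup>2 - v\<^sup>2" "y = 2 * u * v"
  have k: "k\<^sup>2 = 1 - s\<^sup>2" and r: "r\<^sup>2 = 2"
    by (simp_all add: defs cos_squared_eq)
  have v: "v\<^sup>2 = (1 - x) / 2" and u: "u\<^sup>2 = (1 + x) / 2"
    using assms by (simp_all add: defs)
  have "y\<^sup>2 = 4 * u\<^sup>2 * v\<^sup>2"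
    by (simp add: defs(5) power_mult_distrib)
  then have y: "y\<^sup>2 = 1 - x\<^sup>2"
    unfolding u v by (simp add: field_simps power2_eq_square)
  have z: "(Complex u v)\<^sup>2 = Complex x y"
    by (simp add: defs power2_eq_square complex_eq_iff)
  have z2: "(Complex x y)\<^sup>2 = Complex (2 * x\<^sup>2 - 1) (2 * x * y)"
    using y by (simp add: power2_eq_square complex_eq_iff)
  have z3: "(Complex x y) ^ 3 = Complex (4 * x ^ 3 - 3 * x) (y * (4 * x\<^sup>2 - 1))"
  proof -
    have "(Complex x y) ^ 3 = (Complex x y)\<^sup>2 * Complex x y"
      by (simp add: power3_eq_cube power2_eq_square)
    moreover have "(2 * x\<^sup>2 - 1) * x - 2 * x * y * y = 4 * x ^ 3 - 3 * x"
      "(2 * x\<^sup>2 - 1) * y + 2 * x * y * x = y * (4 * x\<^sup>2 - 1)"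
      using y by (algebra, simp add: power2_eq_square algebra_simps)
    ultimately show ?thesis
      by (simp add: z2 complex_eq_iff)
  qed
  \<comment> \<open>Grouping by \<open>r * k\<close> and pulling out \<open>y\<close> leaves
    polynomials in \<open>x\<close> and \<open>s\<close>, so that squaring needs only
    \<open>k^2\<close>, \<open>r^2\<close> and \<open>y^2\<close>.\<close>
  define a1 where "a1 = 2 * (-1 - 3 * s) + 3 * (3 + s) * x + 3 * (3 - s) * (2 * x\<^sup>2 - 1)
    + 2 * (3 * s - 1) * (4 * x ^ 3 - 3 * x)"
  define b1 where "b1 = 3 * (3 + s) + 3 * (3 - s) * (2 * x) + 2 * (3 * s - 1) * (4 * x\<^sup>2 - 1)"
  define a2 where "a2 = 4 * x\<^sup>2 - 1"
  define b2 where "b2 = 1 + 4 * x ^ 3 - 3 * x"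
  define a where "a = a1 - 4 * r * k * y * a2"
  define b where "b = b1 * y + 4 * r * k * b2"
  have f: "30 * sidon_f ((Complex u v)\<^sup>2) \<tau> = Complex a b"
    unfolding z
    by (simp add: sidon_f_def z2 z3 complex_eq_iff a_def b_def a1_def b1_def a2_def b2_def cos_of_real sin_of_real flip: defs(1,2,3)) (simp add: field_simps)
  have "(30 * cmod (sidon_f ((Complex u v)\<^sup>2) \<tau>))\<^sup>2 = (cmod (30 * sidon_f ((Complex u v)\<^sup>2) \<tau>))\<^sup>2"
    by (simp add: norm_mult)
  also have "\<dots> = a\<^sup>2 + b\<^sup>2"
    by (simp add: f cmod_power2)
  finally have n: "(30 * cmod (sidon_f ((Complex u v)\<^sup>2) \<tau>))\<^sup>2 = a\<^sup>2 + b\<^sup>2" .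
  have "324 - (a\<^sup>2 + b\<^sup>2) = 18 * k\<^sup>2 * (1 + 4 * x)\<^sup>2 * (1 - x) + 64 * s\<^sup>2 * (2 * x - 1)\<^sup>2 * (1 + x)
     - 48 * r * k * s * (1 + 4 * x) * (2 * x - 1) * y"
  proof -
    have "a\<^sup>2 + b\<^sup>2 = a1\<^sup>2 + b1\<^sup>2 * y\<^sup>2 + 16 * r\<^sup>2 * k\<^sup>2 * (a2\<^sup>2 * y\<^sup>2 + b2\<^sup>2)
        + 8 * r * k * y * (b1 * b2 - a1 * a2)"
      unfolding a_def b_def by algebra
    moreover have "b1 * b2 - a1 * a2 = 6 * s * (1 + 4 * x) * (2 * x - 1)"
      unfolding a1_def b1_def a2_def b2_def by algebra
    moreover have "a1\<^sup>2 + b1\<^sup>2 * (1 - x\<^sup>2) + 32 * (1 - s\<^sup>2) * (a2\<^sup>2 * (1 - x\<^sup>2) + b2\<^sup>2) =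
        324 - 18 * (1 - s\<^sup>2) * (1 + 4 * x)\<^sup>2 * (1 - x) - 64 * s\<^sup>2 * (2 * x - 1)\<^sup>2 * (1 + x)"
      unfolding a1_def b1_def a2_def b2_def by algebra
    ultimately show ?thesis
      unfolding k r y by (simp add: mult_ac)
  qed
  also have "\<dots> = 36 * k\<^sup>2 * (1 + 4 * x)\<^sup>2 * v\<^sup>2 + 64 * r\<^sup>2 * s\<^sup>2 * (2 * x - 1)\<^sup>2 * u\<^sup>2
     - 2 * (6 * k * (1 + 4 * x) * v) * (8 * r * s * (2 * x - 1) * u)"
    by (simp add: u v r) (simp add: defs(5))
  also have "\<dots> = (6 * k * (1 + 4 * x) * v - 8 * r * s * (2 * x - 1) * u)\<^sup>2"
    by (simp add: power2_diff power_mult_distrib)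
  finally show ?thesis
    unfolding n unfolding defs(1-4) .
qed

lemma sidon_f_le:
  assumes "cmod z = 1"
  shows "cmod (sidon_f z \<tau>) \<le> 3 / 5"
proof -
  define u v where "u = Re (csqrt z)" "v = Im (csqrt z)"
  have z: "(Complex u v)\<^sup>2 = z"
    unfolding u_v_def complex_surj by (rule power2_csqrt)
  have "cmod (csqrt z) = 1"
    using assms by simp
  then have "u\<^sup>2 + v\<^sup>2 = 1"
    using cmod_power2[of "csqrt z"] by (simp add: u_v_def)
  then have "0 \<le> 324 - (30 * cmod (sidon_f z \<tau>))\<^sup>2"
    using sidon_f_identity[of u v \<tau>] unfolding z by (metis zero_le_power2)
  then have "(30 * cmod (sidon_f z \<tau>))\<^sup>2 \<le> 18\<^sup>2"
    by simp
  then have "30 * cmod (sidon_f z \<tau>) \<le> 18"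
    by (rule power2_le_imp_le) simp
  then show ?thesis
    by simp
qed

section \<open>Cube roots of unity and the equality case of Fejer's bound\<close>

definition cbrt_unity :: complex where
  "cbrt_unity = Complex (- 1 / 2) (sqrt 3 / 2)"

lemma cbrt_unity_square: "cbrt_unity\<^sup>2 = cnj cbrt_unity"
  by (simp add: cbrt_unity_def complex_eq_iff power2_eq_square)

lemma norm_cbrt_unity: "cmod cbrt_unity = 1"
  by (simp add: cbrt_unity_def cmod_def power2_eq_square)

lemma cbrt_unity_cube: "cbrt_unity ^ 3 = 1"
proof -
  have "cbrt_unity ^ 3 = cbrt_unity * cbrt_unity\<^sup>2"
    by (simp add: power3_eq_cube power2_eq_square)
  then show ?thesis
    by (simp add: cbrt_unity_square complex_norm_square[symmetric] norm_cbrt_unity)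
qed

text \<open>\<open>1\<close> and \<open>cbrt_unity\<close> are linearly independent over the reals,
  so these two real functionals determine \<open>s\<close>.\<close>

lemma Re_mult_cbrt_unity_eq_0:
  assumes "Re s = 0" "Re (s * cbrt_unity) = 0"
  shows "s = 0"
  using assms by (simp add: cbrt_unity_def complex_eq_iff)

text \<open>Rotating by \<open>w\<close> makes the cubic term equal to its modulus at all three cube
  roots of unity simultaneously.\<close>

lemma obtain_aligned_cube:
  fixes r :: complex
  obtains w where "cmod w = 1" "r * w ^ 3 = of_real (cmod r)"
proof
  let ?w = "cis (- Arg r / 3)"
  show "cmod ?w = 1"
    by (rule norm_cis)
  have "?w ^ 3 = cis (real 3 * (- Arg r / 3))"
    by (rule Complex.DeMoivre)
  also have "real 3 * (- Arg r / 3) = - Arg r"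
    by simp
  finally have "r * ?w ^ 3 = rcis (cmod r) (Arg r) * rcis 1 (- Arg r)"
    by (simp only: rcis_cmod_Arg) (simp add: rcis_def)
  also have "\<dots> = of_real (cmod r)"
    by (simp only: rcis_mult) simp
  finally show "r * ?w ^ 3 = of_real (cmod r)" .
qed

text \<open>The equality case of Fejer's bound for the leading coefficient of a nonnegative trigonometric
  polynomial: double zeros at three equidistributed points leave no room for middle coefficients.\<close>

lemma Fejer_equality_case:
  fixes r1 r2 r3 :: complex
  assumes le: "\<And>z. cmod z = 1 \<Longrightarrow> Re (r1 * z + r2 * z\<^sup>2 + r3 * z ^ 3) \<le> cmod r3"
  shows "r1 = 0" "r2 = 0"
proof -
  obtain w where w: "cmod w = 1" "r3 * w ^ 3 = of_real (cmod r3)"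
    using obtain_aligned_cube .
  define s1 s2 where s: "s1 = r1 * w" "s2 = r2 * w\<^sup>2"
  have le': "Re (s1 * z + s2 * z\<^sup>2) + cmod r3 * Re (z ^ 3) \<le> cmod r3" if "cmod z = 1" for z
  proof -
    have "r1 * (w * z) + r2 * (w * z)\<^sup>2 + r3 * (w * z) ^ 3
        = s1 * z + s2 * z\<^sup>2 + of_real (cmod r3) * z ^ 3"
      by (simp add: s power_mult_distrib mult.assoc flip: w(2))
    moreover have "cmod (w * z) = 1"
      using w that by (simp add: norm_mult)
    ultimately show ?thesis
      using le[of "w * z"] by simp
  qed
  let ?o = cbrt_unity
  \<comment> \<open>At each cube root of unity the cubic term exhausts the bound, so the remaining
    part is at most 0; the three remainders add up to 0, hence each is 0.\<close>
  have zero: "Re (s1 + s2) = 0 \<and> Re (s1 * ?o + s2 * ?o\<^sup>2) = 0"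
  proof -
    have "Re (s1 + s2) \<le> 0"
      using le'[of 1] by simp
    moreover have "Re (s1 * ?o + s2 * ?o\<^sup>2) \<le> 0"
      using le'[of ?o] by (simp add: norm_cbrt_unity cbrt_unity_cube)
    moreover have "Re (s1 * cnj ?o + s2 * (cnj ?o)\<^sup>2) \<le> 0"
      using le'[of "cnj ?o"]
      by (simp add: norm_cbrt_unity cbrt_unity_cube flip: complex_cnj_power)
    moreover have "Re (s1 + s2) + Re (s1 * ?o + s2 * ?o\<^sup>2) + Re (s1 * cnj ?o + s2 * (cnj ?o)\<^sup>2) = 0"
      by (simp only: cbrt_unity_square flip: complex_cnj_power)
        (simp add: cbrt_unity_def algebra_simps)
    ultimately show ?thesis
      by linarith
  qed
  \<comment> \<open>Such a \<open>z\<close> attains the bound, so it is a maximum along the circle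
    and the derivative in the angle vanishes; the cubic term contributes nothing to it, as the sine
    of \<open>3 * t\<close> is 0 at \<open>t = 0\<close>.\<close>
  have crit: "Re (\<i> * s1 * z + 2 * \<i> * s2 * z\<^sup>2) = 0"
    if z: "cmod z = 1" "z ^ 3 = 1" "Re (s1 * z + s2 * z\<^sup>2) = 0" for z
  proof -
    define g where "g t = Re (s1 * z * cis t + s2 * z\<^sup>2 * cis (2 * t)) + cmod r3 * cos (3 * t)" for t
    have g: "g t = Re (s1 * (z * cis t) + s2 * (z * cis t)\<^sup>2) + cmod r3 * Re ((z * cis t) ^ 3)" for t
    proof -
      have "(z * cis t)\<^sup>2 = z\<^sup>2 * cis (2 * t)" "(z * cis t) ^ 3 = cis (3 * t)"
        using z by (simp_all add: power_mult_distrib Complex.DeMoivre)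
      then show ?thesis
        by (simp add: g_def mult.assoc)
    qed
    have "g t \<le> g 0" for t
      using le'[of "z * cis t"] z unfolding g by (simp add: norm_mult)
    moreover have "(g has_real_derivative Re (\<i> * s1 * z + 2 * \<i> * s2 * z\<^sup>2)) (at 0)"
      unfolding g_def by (auto intro!: derivative_eq_intros)
    ultimately show ?thesis
      using DERIV_local_max[of g _ 0 1] by simp
  qed
  \<comment> \<open>At cube roots of unity \<open>z^2 = cnj z\<close>, so both coefficients merge
    into one.\<close>
  have fold: "Re (s * z + t * cnj z) = Re ((s + cnj t) * z)" for s t z
    by (simp add: algebra_simps)
  have "s1 + cnj s2 = 0"
  proof (rule Re_mult_cbrt_unity_eq_0)
    show "Re (s1 + cnj s2) = 0"
      using zero by simp
    show "Re ((s1 + cnj s2) * ?o) = 0"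
      using zero unfolding cbrt_unity_square fold by blast
  qed
  moreover have "\<i> * s1 + cnj (2 * \<i> * s2) = 0"
  proof (rule Re_mult_cbrt_unity_eq_0)
    show "Re (\<i> * s1 + cnj (2 * \<i> * s2)) = 0"
      using crit[of 1] zero by simp
    have "Re (\<i> * s1 * ?o + 2 * \<i> * s2 * ?o\<^sup>2) = 0"
      using zero by (intro crit norm_cbrt_unity cbrt_unity_cube) blast
    then show "Re ((\<i> * s1 + cnj (2 * \<i> * s2)) * ?o) = 0"
      unfolding cbrt_unity_square fold .
  qed
  \<comment> \<open>The two relations say \<open>s1 = - cnj s2\<close> and
    \<open>s1 = 2 * cnj s2\<close>.\<close>
  ultimately have "s1 = 0" "s2 = 0"
    by (auto simp: complex_eq_iff)
  then show "r1 = 0" "r2 = 0"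
    using w by (auto simp: s)
qed

section \<open>The maximum of a cubic on the unit circle\<close>

text \<open>On the circle \<open>cnj z\<close> is the inverse of \<open>z\<close>, so the product of
  the cubic with its conjugate is a trigonometric polynomial with the autocorrelations as
  coefficients.\<close>

lemma cmod_cubic_square:
  fixes a b c d z :: complex
  assumes "cmod z = 1"
  shows "(cmod (a + b * z + c * z\<^sup>2 + d * z ^ 3))\<^sup>2 =
    (cmod a)\<^sup>2 + (cmod b)\<^sup>2 + (cmod c)\<^sup>2 + (cmod d)\<^sup>2 +
    2 * Re ((b * cnj a + c * cnj b + d * cnj c) * z + (c * cnj a + d * cnj b) * z\<^sup>2 + d * cnj a * z ^ 3)"
proof -
  define y where "y = cnj z"
  have zy: "z * y = 1"
    using assms by (simp add: y_def complex_norm_square[symmetric])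
  define P where "P = (b * cnj a + c * cnj b + d * cnj c) * z + (c * cnj a + d * cnj b) * z\<^sup>2 + d * cnj a * z ^ 3"
  have "complex_of_real ((cmod (a + b * z + c * z\<^sup>2 + d * z ^ 3))\<^sup>2) =
     (a + b * z + c * z\<^sup>2 + d * z ^ 3) * (cnj a + cnj b * y + cnj c * y\<^sup>2 + cnj d * y ^ 3)"
    unfolding complex_norm_square y_def by simp
  also have "\<dots> = a * cnj a + b * cnj b + c * cnj c + d * cnj d + (P + 
     ((cnj b * a + cnj c * b + cnj d * c) * y + (cnj c * a + cnj d * b) * y\<^sup>2 + cnj d * a * y ^ 3))"
    unfolding P_def using zy by algebra
  also have "(cnj b * a + cnj c * b + cnj d * c) * y + (cnj c * a + cnj d * b) * y\<^sup>2 + cnj d * a * y ^ 3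
     = cnj P"
    by (simp add: P_def y_def)
  also have "a * cnj a + b * cnj b + c * cnj c + d * cnj d + (P + cnj P) =
     of_real ((cmod a)\<^sup>2 + (cmod b)\<^sup>2 + (cmod c)\<^sup>2 + (cmod d)\<^sup>2 + 2 * Re P)"
    by (simp only: complex_add_cnj of_real_add complex_norm_square)
  finally show ?thesis
    unfolding P_def of_real_eq_iff .
qed

text \<open>The aligned lag 3 term completes the squares of \<open>cmod a\<close> and
  \<open>cmod d\<close> to the square of their sum, while lags 1 and 2 cancel over the three
  points.\<close>

lemma cubic_average_le:
  fixes a b c d :: complex
  assumes le: "\<And>z. cmod z = 1 \<Longrightarrow> cmod (a + b * z + c * z\<^sup>2 + d * z ^ 3) \<le> M"
  shows "(cmod a + cmod d)\<^sup>2 + (cmod b)\<^sup>2 + (cmod c)\<^sup>2 \<le> M\<^sup>2"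
proof -
  define r1 r2 where r: "r1 = b * cnj a + c * cnj b + d * cnj c" "r2 = c * cnj a + d * cnj b"
  obtain w where w: "cmod w = 1" "d * cnj a * w ^ 3 = of_real (cmod (d * cnj a))"
    using obtain_aligned_cube .
  let ?o = cbrt_unity
  define A where "A = (cmod a + cmod d)\<^sup>2 + (cmod b)\<^sup>2 + (cmod c)\<^sup>2"
  have pt: "A + 2 * Re (r1 * w * z + r2 * w\<^sup>2 * z\<^sup>2) \<le> M\<^sup>2" if z: "cmod z = 1" "z ^ 3 = 1" for z
  proof -
    have "(cmod (a + b * (w * z) + c * (w * z)\<^sup>2 + d * (w * z) ^ 3))\<^sup>2 \<le> M\<^sup>2"
      using w z by (intro power_mono le) (auto simp: norm_mult)
    moreover have "r1 * (w * z) + r2 * (w * z)\<^sup>2 + d * cnj a * (w * z) ^ 3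
        = r1 * w * z + r2 * w\<^sup>2 * z\<^sup>2 + of_real (cmod (d * cnj a))"
      by (simp only: power_mult_distrib z(2) mult_1_right w(2) mult.assoc[symmetric])
    moreover have "cmod (w * z) = 1"
      using w z by (simp add: norm_mult)
    ultimately have "(cmod a)\<^sup>2 + (cmod b)\<^sup>2 + (cmod c)\<^sup>2 + (cmod d)\<^sup>2 +
        2 * Re (r1 * w * z + r2 * w\<^sup>2 * z\<^sup>2 + of_real (cmod (d * cnj a))) \<le> M\<^sup>2"
      using cmod_cubic_square[of "w * z" a b c d] by (simp only: flip: r)
    then have "(cmod a)\<^sup>2 + (cmod b)\<^sup>2 + (cmod c)\<^sup>2 + (cmod d)\<^sup>2 +
        2 * Re (r1 * w * z + r2 * w\<^sup>2 * z\<^sup>2) + 2 * (cmod a * cmod d) \<le> M\<^sup>2"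
      by (simp only: plus_complex.sel Re_complex_of_real norm_mult complex_mod_cnj)
        (simp add: algebra_simps)
    then show ?thesis
      by (simp add: A_def power2_sum)
  qed
  define s1 s2 where s: "s1 = r1 * w" "s2 = r2 * w\<^sup>2"
  have "Re (s1 + s2) + Re (s1 * ?o + s2 * ?o\<^sup>2) + Re (s1 * cnj ?o + s2 * (cnj ?o)\<^sup>2) = 0"
    by (simp only: cbrt_unity_square flip: complex_cnj_power)
      (simp add: cbrt_unity_def algebra_simps)
  moreover have "A + 2 * Re (s1 + s2) \<le> M\<^sup>2"
    using pt[of 1] by (simp add: s)
  moreover have "A + 2 * Re (s1 * ?o + s2 * ?o\<^sup>2) \<le> M\<^sup>2"
    unfolding s by (intro pt norm_cbrt_unity cbrt_unity_cube)
  moreover have "A + 2 * Re (s1 * cnj ?o + s2 * (cnj ?o)\<^sup>2) \<le> M\<^sup>2"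
    unfolding s by (intro pt) (simp_all add: norm_cbrt_unity cbrt_unity_cube flip: complex_cnj_power)
  ultimately have "A \<le> M\<^sup>2"
    by linarith
  then show ?thesis
    by (simp add: A_def)
qed

text \<open>Cauchy-Schwarz with its defect explicit, so that equality forces each term to be
  1/3.\<close>

lemma sum_squares_eq_third_plus:
  fixes x y z :: real
  assumes "x + y + z = 1"
  shows "x\<^sup>2 + y\<^sup>2 + z\<^sup>2 = 1 / 3 + (x - 1 / 3)\<^sup>2 + (y - 1 / 3)\<^sup>2 + (z - 1 / 3)\<^sup>2"
proof -
  have "x = 1 - y - z"
    using assms by simp
  then show ?thesis
    by (simp add: power2_eq_square algebra_simps)
qed

lemma cubic_bound_gt:
  fixes a b c d :: complex
  assumes sum: "cmod a + cmod b + cmod c + cmod d = 1"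
    and le: "\<And>z. cmod z = 1 \<Longrightarrow> cmod (a + b * z + c * z\<^sup>2 + d * z ^ 3) \<le> M"
  shows "1 / 3 < M\<^sup>2"
proof (rule ccontr)
  assume "\<not> 1 / 3 < M\<^sup>2"
  define x y t where xyt: "x = cmod a + cmod d" "y = cmod b" "t = cmod c"
  have sq: "x\<^sup>2 + y\<^sup>2 + t\<^sup>2 = 1 / 3 + (x - 1 / 3)\<^sup>2 + (y - 1 / 3)\<^sup>2 + (t - 1 / 3)\<^sup>2"
    using sum by (intro sum_squares_eq_third_plus) (simp add: xyt)
  have avg: "x\<^sup>2 + y\<^sup>2 + t\<^sup>2 \<le> M\<^sup>2"
    unfolding xyt by (rule cubic_average_le) (rule le)
  have nn: "0 \<le> (x - 1 / 3)\<^sup>2" "0 \<le> (y - 1 / 3)\<^sup>2" "0 \<le> (t - 1 / 3)\<^sup>2"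
    by simp_all
  have M: "M\<^sup>2 = x\<^sup>2 + y\<^sup>2 + t\<^sup>2" "(y - 1 / 3)\<^sup>2 = 0" "(t - 1 / 3)\<^sup>2 = 0"
    using sq avg nn \<open>\<not> 1 / 3 < M\<^sup>2\<close> by linarith+
  then have bc: "cmod b = 1 / 3" "cmod c = 1 / 3"
    by (simp_all add: xyt)
  have "Re ((b * cnj a + c * cnj b + d * cnj c) * z + (c * cnj a + d * cnj b) * z\<^sup>2 + d * cnj a * z ^ 3)
      \<le> cmod (d * cnj a)" if "cmod z = 1" for z
  proof -
    have "(cmod (a + b * z + c * z\<^sup>2 + d * z ^ 3))\<^sup>2 \<le> M\<^sup>2"
      using that by (intro power_mono le) auto
    moreover have "M\<^sup>2 = (cmod a)\<^sup>2 + (cmod b)\<^sup>2 + (cmod c)\<^sup>2 + (cmod d)\<^sup>2 + 2 * cmod (d * cnj a)"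
      by (simp add: M(1) xyt power2_sum norm_mult)
    ultimately show ?thesis
      unfolding cmod_cubic_square[OF that] by linarith
  qed
  note lags = Fejer_equality_case[OF this]
  \<comment> \<open>Multiply the lag 1 relation by \<open>c\<close> and replace
    \<open>c * cnj a\<close> by \<open>- d * cnj b\<close>: the terms with \<open>d\<close> cancel
    because \<open>b\<close> and \<open>c\<close> have equal modulus.\<close>
  have "b * cnj b = c * cnj c"
    unfolding complex_norm_square[symmetric] bc by simp
  then have "c * (c * cnj b) = 0"
    using lags by algebra
  then show False
    using bc by auto
qed

section \<open>The Sidon constant\<close>

lemma trig_poly_0123:
  "trig_poly {0, 1, 2, 3} c z = c 0 + c 1 * z + c 2 * z\<^sup>2 + c 3 * z ^ 3"
  by (simp add: trig_poly_def)

lemma circle_max_0123_gt: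
  assumes "(\<Sum>k\<in>{0, 1, 2, 3}. cmod (c k)) = 1"
  shows "1 / sqrt 3 < circle_max (trig_poly {0, 1, 2, 3} c)"
proof -
  let ?M = "circle_max (trig_poly {0, 1, 2, 3} c)"
  have le: "cmod (trig_poly {0, 1, 2, 3} c z) \<le> ?M" if "cmod z = 1" for z
    unfolding circle_max_def using that by (intro cSUP_upper bdd_above_trig_poly) auto
  have "1 / 3 < ?M\<^sup>2"
    using assms by (intro cubic_bound_gt[of "c 0" "c 1" "c 2" "c 3"]) (simp_all add: le flip: trig_poly_0123)
  then have "(1 / sqrt 3)\<^sup>2 < ?M\<^sup>2"
    by (simp add: power_divide)
  moreover have "0 \<le> ?M"
    by (rule order_trans[OF norm_ge_zero le[of 1]]) simp
  ultimately show ?thesis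
    by (rule power2_less_imp_less)
qed

lemma Sidon_constant_0123_lower: "5 / 3 \<le> Sidon_constant {0, 1, 2, 3}"
proof -
  have fin: "finite {0, 1, 2, 3 :: int}" and ne: "{0, 1, 2, 3 :: int} \<noteq> {}"
    by simp_all
  obtain c where c: "(\<Sum>k\<in>{0, 1, 2, 3}. cmod (c k)) = 1"
    "Sidon_constant {0, 1, 2, 3} = inverse (circle_max (trig_poly {0, 1, 2, 3} c))"
    and min: "\<And>d. (\<Sum>k\<in>{0, 1, 2, 3}. cmod (d k)) = 1 \<Longrightarrow>
       circle_max (trig_poly {0, 1, 2, 3} c) \<le> circle_max (trig_poly {0, 1, 2, 3} d)"
    using Sidon_constant_min[OF fin ne] by blast
  \<comment> \<open>The witness is \<open>sidon_f\<close> at \<open>\<tau> = 0\<close>, where both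
    outer coefficients equal \<open>e\<close> and both inner ones 3/10; the moduli add up to 1/5 +
    3/10 + 3/10 + 1/5 = 1.\<close>
  define e where "e = Complex (- 1 / 15) (2 * sqrt 2 / 15)"
  define d :: "int \<Rightarrow> complex" where "d k = (if k = 1 \<or> k = 2 then 3 / 10 else e)" for k
  have "cmod e = sqrt ((1 / 5)\<^sup>2)"
    unfolding e_def cmod_def by (simp add: power_divide power_mult_distrib)
  then have "cmod e = 1 / 5"
    by (simp only: real_sqrt_abs)
  then have "(\<Sum>k\<in>{0, 1, 2, 3}. cmod (d k)) = 1"
    by (simp add: d_def norm_divide)
  then have "circle_max (trig_poly {0, 1, 2, 3} c) \<le> circle_max (trig_poly {0, 1, 2, 3} d)"
    by (rule min)
  also have "circle_max (trig_poly {0, 1, 2, 3} d) \<le> 3 / 5"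
    unfolding circle_max_def
  proof (intro cSUP_least)
    fix z :: complex assume "z \<in> sphere 0 1"
    then have "cmod (sidon_f z 0) \<le> 3 / 5"
      by (intro sidon_f_le) simp
    moreover have "e = (2 * sqrt 2 * \<i> - 1) / 15"
      by (simp add: e_def complex_eq_iff)
    then have "trig_poly {0, 1, 2, 3} d z = sidon_f z 0"
      by (simp add: trig_poly_0123 sidon_f_def d_def del: divide_eq_eq_numeral1 eq_divide_eq_numeral1)
    ultimately show "cmod (trig_poly {0, 1, 2, 3} d z) \<le> 3 / 5"
      by simp
  qed simp
  finally have "circle_max (trig_poly {0, 1, 2, 3} c) \<le> 3 / 5" .
  moreover have "0 < circle_max (trig_poly {0, 1, 2, 3} c)"
    by (rule less_trans[OF _ circle_max_0123_gt[OF c(1)]]) simp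
  ultimately show ?thesis
    using le_imp_inverse_le[of _ "3 / 5 :: real"] by (simp add: c(2))
qed

text \<open>The strict inequality survives the infimum because a minimizer exists.\<close>

lemma Sidon_constant_0123_upper: "Sidon_constant {0, 1, 2, 3} < sqrt 3"
proof -
  have fin: "finite {0, 1, 2, 3 :: int}" and ne: "{0, 1, 2, 3 :: int} \<noteq> {}"
    by simp_all
  obtain c where c: "(\<Sum>k\<in>{0, 1, 2, 3}. cmod (c k)) = 1"
    "Sidon_constant {0, 1, 2, 3} = inverse (circle_max (trig_poly {0, 1, 2, 3} c))"
    using Sidon_constant_min[OF fin ne] by blast
  show ?thesis
    using less_imp_inverse_less[OF circle_max_0123_gt[OF c(1)]] by (simp add: c(2))
qed

theorem mainTheorem1:
  shows "(\<forall>\<tau>::real. \<forall>z\<in>sphere (0::complex) 1. cmod (sidon_f z \<tau>) \<le> 3 / 5) \<and>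
         5 / 3 \<le> Sidon_constant {0, 1, 2, 3} \<and> Sidon_constant {0, 1, 2, 3} < sqrt 3"
  using sidon_f_le Sidon_constant_0123_lower Sidon_constant_0123_upper by simp

end
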